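(* Let $\mathcal{H}$ be a real Hilbert space, $T:\mathcal{H}\rightrightarrows\mathcal{H}$ maximal monotone with $T^{-1}(0)\neq\emptyset$, and let $z^*\in T^{-1}(0)$. Let $\delta>0$ and let $\{z^k\}$ be any sequence generated by the Halpern accelerated inexact proximal point algorithm (described in the context) with constant parameter $c_k\equiv c>0$ under criterion (A) with tolerances $\varepsilon_k=\frac{1}{(k+2)^{1+\delta}}$, $k=0,1,\ldots$. Put $\beta_0=\sum_{k=0}^\infty\frac{1}{(k+2)^{1+\delta}}$ and $\kappa_0=2(\beta_0+\|z^0-z^*\|)$. Then for positive integers $k$, $$\|z^k-P_c(z^k)\|\le\begin{cases} O\!\left(\sqrt{\dfrac{8\kappa_0}{2-\delta}}\;\dfrac{1}{(k+1)^{\delta/2}}\right), & 0<\delta<2,\\[3mm] O\!\left(\sqrt{8\kappa_0\dfrac{\ln(k+1)}{(k+1)^2}}\right), & \delta=2,\\[3mm] O\!\left(\sqrt{8\kappa_0\Big(\dfrac{1}{\delta-1}+\dfrac{1}{\delta-2}+\beta_0\Big)+4\|z^0-z^*\|^2}\;\dfrac{1}{k+1}\right), & \delta>2. \end{cases}$$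
   Context: For $c>0$, $P_c=(I+cT)^{-1}$ is the (single-valued, everywhere defined) proximal mapping of $T$. $T^{-1}(0)=\{z\in\mathcal{H}:0\in T(z)\}$. Halpern accelerated inexact proximal point algorithm: choose $z^0\in\mathcal{H}$ and a sequence of parameters $c_k>0$; for $k=0,1,2,\ldots$ compute $\bar z^k\approx P_{c_k}(z^k)$ according to an inexactness criterion, and set $$z^{k+1}=\frac{1}{k+2}z^0+\frac{k+1}{k+2}\bar z^k .$$ Criterion (A): $\|\bar z^k-P_{c_k}(z^k)\|\le\varepsilon_k$ for all $k\ge 0$, where $\varepsilon_k\ge 0$ and $\sum_{k=0}^\infty\varepsilon_k<+\infty$. The notation "$a_k\le O(b_k)$" means that there is a constant $C>0$, independent of $k$, with $a_k\le C\,b_k$ for all positive integers $k$. *)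

theory Defs
  imports "HOL-Analysis.Analysis"
begin

text \<open>
  A set-valued operator on \<open>\<H>\<close> is a function of type \<open>'a \<Rightarrow> 'a set\<close>. A real Hilbert space is
  a type of sort \<open>{real_inner, complete_space}\<close>.
\<close>

definition monotone_operator :: "('a::real_inner \<Rightarrow> 'a set) \<Rightarrow> bool" where
  "monotone_operator T \<longleftrightarrow>
     (\<forall>x y. \<forall>u\<in>T x. \<forall>v\<in>T y. inner (x - y) (u - v) \<ge> 0)"

definition maximal_monotone :: "('a::real_inner \<Rightarrow> 'a set) \<Rightarrow> bool" where
  "maximal_monotone T \<longleftrightarrow>
     monotone_operator T \<and>
     (\<forall>S. monotone_operator S \<and> (\<forall>x. T x \<subseteq> S x) \<longrightarrow> S = T)"

definition inv_operator :: "('a \<Rightarrow> 'b set) \<Rightarrow> 'b \<Rightarrow> 'a set" where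
  "inv_operator T u = {x. u \<in> T x}"

text \<open>
  The proximal mapping \<open>P\<^sub>c = (I + c T)\<inverse>\<close>. The set \<open>(I + c T)\<inverse>(z)\<close> is a singleton for every \<open>z\<close>
  when \<open>T\<close> is maximal monotone and \<open>c > 0\<close> (Minty's theorem); otherwise the value of \<open>prox\<close>
  may be unspecified.
\<close>

definition prox :: "('a::real_inner \<Rightarrow> 'a set) \<Rightarrow> real \<Rightarrow> 'a \<Rightarrow> 'a" where
  "prox T c z = (THE w. w \<in> inv_operator (\<lambda>x. (\<lambda>v. x + c *\<^sub>R v) ` T x) z)"

definition criterion_A ::
  "('a::real_inner \<Rightarrow> 'a set) \<Rightarrow> (nat \<Rightarrow> real) \<Rightarrow> (nat \<Rightarrow> real) \<Rightarrow> (nat \<Rightarrow> 'a) \<Rightarrow> (nat \<Rightarrow> 'a) \<Rightarrow> bool" where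
  "criterion_A T c \<epsilon> z zbar \<longleftrightarrow>
     (\<forall>k. \<epsilon> k \<ge> 0) \<and> summable \<epsilon> \<and>
     (\<forall>k. norm (zbar k - prox T (c k) (z k)) \<le> \<epsilon> k)"

definition halpern_inexact_ppa ::
  "('a::real_inner \<Rightarrow> 'a set) \<Rightarrow> (nat \<Rightarrow> real) \<Rightarrow> (nat \<Rightarrow> real) \<Rightarrow> (nat \<Rightarrow> 'a) \<Rightarrow> bool" where
  "halpern_inexact_ppa T c \<epsilon> z \<longleftrightarrow>
     (\<forall>k. c k > 0) \<and>
     (\<exists>zbar. criterion_A T c \<epsilon> z zbar \<and>
       (\<forall>k. z (Suc k) = (1 / (real k + 2)) *\<^sub>R z 0 + ((real k + 1) / (real k + 2)) *\<^sub>R zbar k))"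

text \<open>
  \<open>a\<^sub>k \<le> O(b\<^sub>k)\<close>: the constant is independent of \<open>k\<close> only, and the bound is required for all positive
  \<open>k\<close>, unlike in the eventual notion of \<open>HOL-Library.Landau_Symbols\<close>.
\<close>

definition le_bigO :: "(nat \<Rightarrow> real) \<Rightarrow> (nat \<Rightarrow> real) \<Rightarrow> bool" where
  "le_bigO a b \<longleftrightarrow> (\<exists>C>0. \<forall>k\<ge>1. a k \<le> C * b k)"

end

theory Submission
  imports Defs
begin

text \<open>
  The implicit constants may depend on everything but \<open>k\<close>, so only the decay rates matter. Compare
  the inexact iterates \<open>z\<^sup>k\<close> with the exact Halpern iterates \<open>w\<^sup>k\<close> of the nonexpansive map \<open>P\<^sub>c\<close> from
  the same starting point. The exact ones satisfy \<open>(k + 1) \<parallel>w\<^sup>k - P\<^sub>c w\<^sup>k\<parallel> \<le> 2 \<parallel>z\<^sup>0 - z\<^sup>*\<parallel>\<close> by a potential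
  argument, and nonexpansiveness gives \<open>(k + 1) \<parallel>z\<^sup>k - w\<^sup>k\<parallel> \<le> \<Sum>j<k. (j + 1) \<epsilon>\<^sub>j\<close>, a sum that is bounded for
  \<open>\<delta> \<ge> 2\<close> and of order at most \<open>k\<close> to the power \<open>1 - \<delta>/2\<close> for \<open>\<delta> < 2\<close>.

  That \<open>P\<^sub>c\<close> is everywhere defined is Minty's theorem. It is obtained by minimising
  \<open>F(x, u) + (\<parallel>x\<parallel>\<^sup>2 + \<parallel>u\<parallel>\<^sup>2) / 2\<close>, where \<open>F\<close> is the Fitzpatrick function of the graph of the operator; as
  \<open>F\<close> may be infinite, the minimisation takes place over its epigraph.
\<close>

section \<open>Minimising a strongly convex objective over a closed convex epigraph\<close>

text \<open>Strong convexity in \<open>p\<close> makes the \<open>p\<close>-components of a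
  minimising sequence Cauchy. The \<open>t\<close>-components then converge too, being objective
  values minus half squared norms, and closedness keeps the limit in \<open>E\<close>.\<close>

lemma strongly_convex_minimizer:
  fixes E :: "('b::{real_inner, complete_space} \<times> real) set"
  assumes "closed E" and "convex E" and "E \<noteq> {}"
    and below: "\<And>p t. (p, t) \<in> E \<Longrightarrow> m \<le> t + (norm p)\<^sup>2 / 2"
  obtains p0 t0 where "(p0, t0) \<in> E"
    and "\<And>p t. (p, t) \<in> E \<Longrightarrow> t0 + (norm p0)\<^sup>2 / 2 \<le> t + (norm p)\<^sup>2 / 2"
proof -
  define g :: "'b \<times> real \<Rightarrow> real" where "g = (\<lambda>q. snd q + (norm (fst q))\<^sup>2 / 2)"
  define I where "I = Inf (g ` E)"
  have bdd: "bdd_below (g ` E)"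
    using below by (intro bdd_belowI[of _ m]) (auto simp: g_def)
  have I_le: "I \<le> g q" if "q \<in> E" for q
    unfolding I_def using bdd that by (intro cInf_lower) auto
  define h where "h = (\<lambda>n. 1 / (real n + 1))"
  have "\<exists>q\<in>E. g q < I + h n" for n
    using cInf_lessD[of "g ` E" "I + h n"] \<open>E \<noteq> {}\<close>
    by (auto simp: I_def h_def)
  then obtain q where qE: "\<And>n. q n \<in> E" and q_less: "\<And>n. g (q n) < I + h n"
    by metis
  have dist_bound: "(norm (fst (q n) - fst (q k)))\<^sup>2 \<le> 4 * (h n + h k)" for n k
  proof -
    obtain p t where n: "q n = (p, t)" by fastforce
    obtain p' t' where k: "q k = (p', t')" by fastforce
    \<comment> \<open>The objective at the midpoint is at least \<open>I\<close>; the parallelogram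
      law turns this into a bound on the distance.\<close>
    have "(1/2) *\<^sub>R q n + (1/2) *\<^sub>R q k \<in> E"
      using convexD[OF \<open>convex E\<close> qE qE, of "1/2" "1/2"] by simp
    then have "I \<le> (t + t') / 2 + (norm ((1/2) *\<^sub>R (p + p')))\<^sup>2 / 2"
      using I_le[of "(1/2) *\<^sub>R q n + (1/2) *\<^sub>R q k"] by (simp add: g_def n k scaleR_add_right add_divide_distrib)
    also have "\<dots> = (g (q n) + g (q k)) / 2 - (norm (p - p'))\<^sup>2 / 8"
      by (simp add: g_def n k power2_norm_eq_inner inner_simps inner_commute field_simps)
    finally show ?thesis using q_less[of n] q_less[of k] unfolding n k fst_conv by argo
  qed
  have "Cauchy (\<lambda>n. fst (q n))"
    unfolding Cauchy_def
  proof (intro allI impI)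
    fix e :: real assume "e > 0"
    obtain M where M: "8 / e\<^sup>2 < real M" using reals_Archimedean2 by blast
    have small: "h n < e\<^sup>2 / 8" if "n \<ge> M" for n
    proof -
      have "8 / e\<^sup>2 < real n + 1" using M that by linarith
      then show ?thesis using \<open>e > 0\<close> by (simp add: h_def field_simps)
    qed
    have "dist (fst (q n)) (fst (q k)) < e" if "n \<ge> M" "k \<ge> M" for n k
    proof -
      have "(norm (fst (q n) - fst (q k)))\<^sup>2 < e\<^sup>2"
        using dist_bound[of n k] small[OF that(1)] small[OF that(2)] by argo
      then show ?thesis using \<open>e > 0\<close> by (simp add: dist_norm power2_less_imp_less)
    qed
    then show "\<exists>M. \<forall>m\<ge>M. \<forall>n\<ge>M. dist (fst (q m)) (fst (q n)) < e" by blast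
  qed
  then obtain p0 where p0: "(\<lambda>n. fst (q n)) \<longlonglongrightarrow> p0"
    using Cauchy_convergent_iff convergent_def by blast
  have "(\<lambda>n. I + h n) \<longlonglongrightarrow> I + 0"
    using LIMSEQ_inverse_real_of_nat unfolding h_def by (intro tendsto_intros) (simp add: inverse_eq_divide add.commute)
  then have g_lim: "(\<lambda>n. g (q n)) \<longlonglongrightarrow> I"
    by (intro tendsto_sandwich[of "\<lambda>_. I" "\<lambda>n. g (q n)" _ "\<lambda>n. I + h n"])
       (simp_all add: I_le qE less_imp_le[OF q_less])
  define t0 where "t0 = I - (norm p0)\<^sup>2 / 2"
  have "(\<lambda>n. g (q n) - (norm (fst (q n)))\<^sup>2 / 2) \<longlonglongrightarrow> t0"
    unfolding t0_def using g_lim p0 by (intro tendsto_intros) auto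
  then have "(\<lambda>n. snd (q n)) \<longlonglongrightarrow> t0" by (simp add: g_def)
  from tendsto_Pair[OF p0 this] have "q \<longlonglongrightarrow> (p0, t0)" by simp
  then have "(p0, t0) \<in> E"
    using \<open>closed E\<close> qE closed_sequentially by blast
  moreover have "t0 + (norm p0)\<^sup>2 / 2 \<le> t + (norm p)\<^sup>2 / 2" if "(p, t) \<in> E" for p t
    using I_le[OF that] by (simp add: t0_def g_def)
  ultimately show ?thesis using that by blast
qed

text \<open>First-order optimality: compare the minimiser with the point a fraction \<open>s\<close>
  of the way to \<open>(p, t)\<close>, divide by \<open>s\<close> and let \<open>s\<close> tend to
  0.\<close>

lemma strongly_convex_variational_inequality:
  fixes E :: "('b::real_inner \<times> real) set"
  assumes "convex E" and p0: "(p0, t0) \<in> E"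
    and min: "\<And>p t. (p, t) \<in> E \<Longrightarrow> t0 + (norm p0)\<^sup>2 / 2 \<le> t + (norm p)\<^sup>2 / 2"
    and p: "(p, t) \<in> E"
  shows "t0 \<le> t + inner p0 (p - p0)"
proof -
  define d where "d = p - p0"
  have "0 \<le> (t - t0) + inner p0 d + s * (norm d)\<^sup>2 / 2" if s: "0 < s" "s < 1" for s :: real
  proof -
    have "(1 - s) *\<^sub>R (p0, t0) + s *\<^sub>R (p, t) \<in> E"
      using s by (intro convexD[OF \<open>convex E\<close> p0 p]) auto
    moreover have "(1 - s) *\<^sub>R (p0, t0) + s *\<^sub>R (p, t) = (p0 + s *\<^sub>R d, t0 + s * (t - t0))"
      by (simp add: d_def algebra_simps)
    ultimately have "t0 + (norm p0)\<^sup>2 / 2 \<le> t0 + s * (t - t0) + (norm (p0 + s *\<^sub>R d))\<^sup>2 / 2"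
      using min by simp
    moreover have "(norm (p0 + s *\<^sub>R d))\<^sup>2 = (norm p0)\<^sup>2 + 2 * s * inner p0 d + s\<^sup>2 * (norm d)\<^sup>2"
      unfolding power2_norm_eq_inner by (simp add: inner_simps inner_commute power2_eq_square algebra_simps)
    moreover have "s * ((t - t0) + inner p0 d + s * (norm d)\<^sup>2 / 2) =
        s * (t - t0) + (2 * s * inner p0 d + s\<^sup>2 * (norm d)\<^sup>2) / 2"
      by (simp add: field_simps power2_eq_square)
    ultimately have "0 \<le> s * ((t - t0) + inner p0 d + s * (norm d)\<^sup>2 / 2)"
      by argo
    then show ?thesis using s by (simp add: zero_le_mult_iff)
  qed
  then have "eventually (\<lambda>s. 0 \<le> (t - t0) + inner p0 d + s * (norm d)\<^sup>2 / 2) (at_right 0)"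
    by (intro eventually_at_rightI[of 0 1]) auto
  moreover have "((\<lambda>s. (t - t0) + inner p0 d + s * (norm d)\<^sup>2 / 2) \<longlongrightarrow>
      (t - t0) + inner p0 d + 0 * (norm d)\<^sup>2 / 2) (at_right 0)"
    by (intro tendsto_intros) auto
  ultimately have "0 \<le> (t - t0) + inner p0 d + 0 * (norm d)\<^sup>2 / 2"
    by (intro tendsto_lowerbound) auto
  then show ?thesis by (simp add: d_def)
qed

section \<open>Minty's theorem\<close>

text \<open>The minimiser \<open>(x, u)\<close> of the Fitzpatrick function plus half the squared
  norm yields \<open>(- u, - x)\<close>, which is monotonically related to \<open>G\<close> and so
  lies in it; testing optimality at this very point forces \<open>u = - x\<close>.\<close>

lemma minty_at_zero:
  fixes G :: "('a::{real_inner, complete_space} \<times> 'a) set"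
  assumes mono: "\<And>x u y v. (x, u) \<in> G \<Longrightarrow> (y, v) \<in> G \<Longrightarrow> 0 \<le> inner (x - y) (u - v)"
    and max: "\<And>x u. (\<And>y v. (y, v) \<in> G \<Longrightarrow> 0 \<le> inner (x - y) (u - v)) \<Longrightarrow> (x, u) \<in> G"
  shows "\<exists>x. (x, - x) \<in> G"
proof -
  \<comment> \<open>the epigraph of the Fitzpatrick function of \<open>G\<close>\<close>
  define E where "E = (\<Inter>(y, v)\<in>G. {q :: ('a \<times> 'a) \<times> real. inner (v, y) (fst q) - snd q \<le> inner y v})"
  have E_iff: "((x, u), t) \<in> E \<longleftrightarrow> (\<forall>(y, v)\<in>G. inner x v + inner y u - inner y v \<le> t)" for x u t
    by (auto simp: E_def inner_commute algebra_simps)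
  have "closed E"
    unfolding E_def by (intro closed_INT ballI) (auto intro!: closed_Collect_le continuous_intros split: prod.splits)
  have "convex {q :: ('a \<times> 'a) \<times> real. inner (v, y) (fst q) - snd q \<le> inner y v}" for y v
  proof -
    have "{q :: ('a \<times> 'a) \<times> real. inner (v, y) (fst q) - snd q \<le> inner y v} = {q. inner ((v, y), - 1) q \<le> inner y v}"
      by (auto simp: inner_prod_def)
    then show ?thesis using convex_halfspace_le[of "((v, y), - 1 :: real)"] by simp
  qed
  then have "convex E" unfolding E_def by (intro convex_INT) (auto split: prod.splits)
  \<comment> \<open>Monotonicity bounds the Fitzpatrick function above by the pairing on
    \<open>G\<close>; maximality, in the next claim, bounds it below by the pairing
    everywhere.\<close>
  have E_graph: "((y, v), inner y v) \<in> E" if "(y, v) \<in> G" for y v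
    using mono that by (fastforce simp: E_iff inner_simps inner_commute)
  have E_below: "inner x u \<le> t" if "((x, u), t) \<in> E" for x u t
  proof (cases "(x, u) \<in> G")
    case True
    then show ?thesis using that by (auto simp: E_iff)
  next
    case False
    then obtain y v where "(y, v) \<in> G" "inner (x - y) (u - v) < 0"
      using max by (meson not_le)
    moreover from this have "inner x v + inner y u - inner y v \<le> t" using that by (auto simp: E_iff)
    ultimately show ?thesis by (simp add: inner_simps)
  qed
  have "G \<noteq> {}" using max by blast
  then have "E \<noteq> {}" using E_graph by fastforce
  have sq: "0 \<le> 2 * inner x u + (norm (x, u))\<^sup>2" for x u :: 'a
  proof -
    have "0 \<le> (norm (x + u))\<^sup>2" by simp
    also have "\<dots> = 2 * inner x u + (norm (x, u))\<^sup>2"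
      by (simp add: power2_norm_eq_inner inner_simps inner_commute)
    finally show ?thesis .
  qed
  have below: "0 \<le> t + (norm p)\<^sup>2 / 2" if "(p, t) \<in> E" for p t
    using that E_below[of "fst p" "snd p" t] sq[of "fst p" "snd p"] by simp
  obtain p0 t0 where p0: "(p0, t0) \<in> E"
    and min: "\<And>p t. (p, t) \<in> E \<Longrightarrow> t0 + (norm p0)\<^sup>2 / 2 \<le> t + (norm p)\<^sup>2 / 2"
    using strongly_convex_minimizer[OF \<open>closed E\<close> \<open>convex E\<close> \<open>E \<noteq> {}\<close> below] by blast
  obtain x u where xu: "p0 = (x, u)" by fastforce
  have "inner x u \<le> t0" using E_below p0 xu by blast
  \<comment> \<open>The variational inequality at \<open>((y, v), inner y v)\<close>, with
    \<open>t0\<close> replaced by the smaller \<open>inner x u\<close>; adding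
    \<open>inner x u\<close> to both sides completes the square on the left and factors the
    right.\<close>
  have key: "(norm (x + u))\<^sup>2 \<le> inner (- u - y) (- x - v)" if "(y, v) \<in> G" for y v
    using strongly_convex_variational_inequality[OF \<open>convex E\<close> p0 min E_graph[OF that]] \<open>inner x u \<le> t0\<close>
    by (simp add: xu power2_norm_eq_inner inner_simps inner_commute)
  have "(- u, - x) \<in> G"
    by (rule max) (use key in \<open>meson order_trans zero_le_power2\<close>)
  \<comment> \<open>At \<open>(y, v) = (- u, - x)\<close> the right-hand side of \<open>key\<close>
    vanishes.\<close>
  from key[OF this] have "x + u = 0" by simp
  then have "- u = x" by (metis add_eq_0_iff2 minus_equation_iff)
  then show ?thesis using \<open>(- u, - x) \<in> G\<close> by auto
qed

text \<open>Adding the pair \<open>(x, u)\<close> to the graph preserves monotonicity, so by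
  maximality it was already there.\<close>

lemma maximal_monotoneD:
  assumes "maximal_monotone T"
    and rel: "\<And>y v. v \<in> T y \<Longrightarrow> 0 \<le> inner (x - y) (u - v)"
  shows "u \<in> T x"
proof -
  define S where "S = T(x := insert u (T x))"
  have mono: "0 \<le> inner (y - y') (v - v')" if "v \<in> T y" "v' \<in> T y'" for y y' v v'
    using assms(1) that by (auto simp: maximal_monotone_def monotone_operator_def)
  have rel': "0 \<le> inner (y - x) (v - u)" if "v \<in> T y" for y v
    using rel[OF that] by (simp add: inner_simps)
  have "monotone_operator S"
    unfolding monotone_operator_def S_def using mono rel rel' by (auto split: if_splits)
  moreover have "\<forall>y. T y \<subseteq> S y" by (auto simp: S_def)
  ultimately have "S = T" using assms(1) by (simp add: maximal_monotone_def)
  then show ?thesis unfolding S_def by (metis fun_upd_same insertI1)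
qed

theorem minty:
  fixes T :: "'a::{real_inner, complete_space} \<Rightarrow> 'a set"
  assumes "maximal_monotone T" and "c > 0"
  shows "\<exists>w. \<exists>v\<in>T w. w + c *\<^sub>R v = z"
proof -
  \<comment> \<open>The graph of \<open>c T(\<cdot> + z)\<close>, which inherits maximal
    monotonicity. A pair \<open>(x, - x)\<close> in it gives the solution \<open>w = x + z\<close>
    with \<open>v = - x / c\<close>.\<close>
  define G where "G = {(x, u). (1 / c) *\<^sub>R u \<in> T (x + z)}"
  have "\<exists>x. (x, - x) \<in> G"
  proof (rule minty_at_zero)
    fix x u y v assume "(x, u) \<in> G" "(y, v) \<in> G"
    then have "0 \<le> inner ((x + z) - (y + z)) ((1 / c) *\<^sub>R u - (1 / c) *\<^sub>R v)"
      using assms(1) unfolding G_def maximal_monotone_def monotone_operator_def by blast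
    also have "\<dots> = inner (x - y) (u - v) / c" by (simp add: inner_simps diff_divide_distrib)
    finally show "0 \<le> inner (x - y) (u - v)" using \<open>c > 0\<close> by (simp add: zero_le_divide_iff)
  next
    fix x u assume rel: "\<And>y v. (y, v) \<in> G \<Longrightarrow> 0 \<le> inner (x - y) (u - v)"
    have "(1 / c) *\<^sub>R u \<in> T (x + z)"
    proof (rule maximal_monotoneD[OF assms(1)])
      fix y v assume "v \<in> T y"
      then have "0 \<le> inner (x - (y - z)) (u - c *\<^sub>R v)" using \<open>c > 0\<close> by (intro rel) (simp add: G_def)
      also have "u - c *\<^sub>R v = c *\<^sub>R ((1 / c) *\<^sub>R u - v)" using \<open>c > 0\<close> by (simp add: scaleR_diff_right)
      also have "x - (y - z) = x + z - y" by simp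
      finally show "0 \<le> inner (x + z - y) ((1 / c) *\<^sub>R u - v)"
        using \<open>c > 0\<close> unfolding inner_scaleR_right by (simp only: zero_le_mult_iff) simp
    qed
    then show "(x, u) \<in> G" by (simp add: G_def)
  qed
  then obtain x where "(1 / c) *\<^sub>R (- x) \<in> T (x + z)" by (auto simp: G_def)
  moreover have "(x + z) + c *\<^sub>R ((1 / c) *\<^sub>R (- x)) = z" using \<open>c > 0\<close> by simp
  ultimately show ?thesis by blast
qed

section \<open>The proximal mapping\<close>

text \<open>In the expanded square on the right, monotonicity makes the cross term
  nonnegative.\<close>

lemma resolvent_nonexpansive:
  assumes "monotone_operator T" and "c > 0" and "u \<in> T x" and "v \<in> T y"
  shows "norm (x - y) \<le> norm ((x + c *\<^sub>R u) - (y + c *\<^sub>R v))"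
proof (rule power2_le_imp_le)
  have "0 \<le> inner (x - y) (u - v)" using assms by (auto simp: monotone_operator_def)
  then have "0 \<le> 2 * c * inner (x - y) (u - v) + c\<^sup>2 * (norm (u - v))\<^sup>2" using \<open>c > 0\<close> by simp
  moreover have "(norm ((x - y) + c *\<^sub>R (u - v)))\<^sup>2 =
      (norm (x - y))\<^sup>2 + 2 * c * inner (x - y) (u - v) + c\<^sup>2 * (norm (u - v))\<^sup>2"
    unfolding power2_norm_eq_inner inner_add_left inner_add_right inner_scaleR_left inner_scaleR_right
    by (simp add: inner_commute power2_eq_square distrib_left)
  moreover have "(x + c *\<^sub>R u) - (y + c *\<^sub>R v) = (x - y) + c *\<^sub>R (u - v)" by (simp add: algebra_simps)
  ultimately show "(norm (x - y))\<^sup>2 \<le> (norm ((x + c *\<^sub>R u) - (y + c *\<^sub>R v)))\<^sup>2"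
    by (simp only:)
qed simp

text \<open>The uniqueness demanded by \<open>THE\<close> comes from the previous estimate: two
  solutions for the same \<open>z\<close> are at distance 0.\<close>

lemma prox_eqI:
  assumes "monotone_operator T" and "c > 0" and "v \<in> T w" and "w + c *\<^sub>R v = z"
  shows "prox T c z = w"
  unfolding prox_def
proof (rule the_equality)
  show "w \<in> inv_operator (\<lambda>x. (\<lambda>v. x + c *\<^sub>R v) ` T x) z"
    using assms by (auto simp: inv_operator_def)
next
  fix w' assume "w' \<in> inv_operator (\<lambda>x. (\<lambda>v. x + c *\<^sub>R v) ` T x) z"
  then obtain v' where "v' \<in> T w'" "w' + c *\<^sub>R v' = z" by (auto simp: inv_operator_def)
  then show "w' = w" using resolvent_nonexpansive[OF assms(1,2) _ assms(3), of v' w'] assms(4) by simp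
qed

lemma prox_nonexpansive:
  fixes T :: "'a::{real_inner, complete_space} \<Rightarrow> 'a set"
  assumes "maximal_monotone T" and "c > 0"
  shows "norm (prox T c x - prox T c y) \<le> norm (x - y)"
proof -
  have mono: "monotone_operator T" using assms(1) by (simp add: maximal_monotone_def)
  obtain a u where a: "u \<in> T a" "a + c *\<^sub>R u = x" using minty[OF assms] by blast
  obtain b v where b: "v \<in> T b" "b + c *\<^sub>R v = y" using minty[OF assms] by blast
  show ?thesis
    using resolvent_nonexpansive[OF mono \<open>c > 0\<close> a(1) b(1)]
      prox_eqI[OF mono \<open>c > 0\<close> a] prox_eqI[OF mono \<open>c > 0\<close> b] a(2) b(2) by simp
qed

section \<open>The exact Halpern iteration\<close>

text \<open>The error-free run of the algorithm, anchored at its starting point, which serves as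
  comparison sequence.\<close>

primrec halpern :: "('a::real_vector \<Rightarrow> 'a) \<Rightarrow> 'a \<Rightarrow> nat \<Rightarrow> 'a" where
  "halpern P x 0 = x"
| "halpern P x (Suc k) = (1 / (real k + 2)) *\<^sub>R x + ((real k + 1) / (real k + 2)) *\<^sub>R P (halpern P x k)"

text \<open>Cocoercivity of \<open>I - P\<close> with constant 1/2, obtained by expanding the square
  of \<open>P x - P y = (x - y) - ((x - P x) - (y - P y))\<close>.\<close>

lemma nonexpansive_residual_cocoercive:
  fixes P :: "'a::real_inner \<Rightarrow> 'a"
  assumes "norm (P x - P y) \<le> norm (x - y)"
  shows "(norm ((x - P x) - (y - P y)))\<^sup>2 \<le> 2 * inner ((x - P x) - (y - P y)) (x - y)"
proof -
  have "(norm (P x - P y))\<^sup>2 \<le> (norm (x - y))\<^sup>2" using assms by (simp add: power_mono)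
  then show ?thesis by (simp add: power2_norm_eq_inner inner_simps inner_commute)
qed

lemma halpern_potential:
  fixes P :: "'a::real_inner \<Rightarrow> 'a" and x0 :: 'a
  assumes nonexp: "\<And>x y. norm (P x - P y) \<le> norm (x - y)"
  defines "a \<equiv> \<lambda>k. halpern P x0 k - P (halpern P x0 k)"
  shows "real k * (norm (a k))\<^sup>2 \<le> 2 * inner (a k) (x0 - halpern P x0 k)"
proof -
  define x where "x = halpern P x0"
  \<comment> \<open>With the extra weight \<open>k + 1\<close> the potential is nonincreasing in
    \<open>k\<close>, and it starts at 0 because the iteration starts at its anchor.\<close>
  have "(real k + 1) * (real k * (norm (a k))\<^sup>2 - 2 * inner (a k) (x0 - x k)) \<le> 0"
  proof (induction k)
    case 0
    then show ?case by (simp add: x_def)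
  next
    case (Suc k)
    define n where "n = real k + 1"
    define d where "d = x (Suc k) - x k"
    have "n > 0" by (simp add: n_def)
    have step: "(n + 1) *\<^sub>R x (Suc k) = x0 + n *\<^sub>R (x k - a k)"
    proof -
      have "x (Suc k) = (1 / (n + 1)) *\<^sub>R x0 + (n / (n + 1)) *\<^sub>R (x k - a k)"
        by (simp add: x_def a_def n_def add.commute)
      then show ?thesis using \<open>n > 0\<close> by (simp add: scaleR_add_right)
    qed
    \<comment> \<open>The displacement \<open>d\<close> is expressed through the old iterate here
      and through the new one in \<open>d2\<close>. Substituted into cocoercivity between
      consecutive iterates, multiplied by \<open>n * (n + 1)\<close>, they make the products of
      \<open>a (Suc k)\<close> and \<open>a k\<close> cancel.\<close>
    have d1: "(n + 1) *\<^sub>R d = (x0 - x k) - n *\<^sub>R a k"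
      unfolding d_def scaleR_diff_right step by (simp add: algebra_simps)
    have d2: "n *\<^sub>R d = (x0 - x (Suc k)) - n *\<^sub>R a k"
    proof -
      have "n *\<^sub>R x (Suc k) = (x0 + n *\<^sub>R (x k - a k)) - x (Suc k)"
        unfolding step[symmetric] by (simp add: algebra_simps)
      then show ?thesis by (simp add: d_def algebra_simps)
    qed
    have "(norm (a (Suc k) - a k))\<^sup>2 \<le> 2 * inner (a (Suc k) - a k) d"
      using nonexpansive_residual_cocoercive[of P, OF nonexp] by (simp add: a_def x_def d_def)
    then have "n * (n + 1) * (norm (a (Suc k) - a k))\<^sup>2 \<le> n * (n + 1) * (2 * inner (a (Suc k) - a k) d)"
      using \<open>n > 0\<close> by (intro mult_left_mono) auto
    also have "\<dots> = 2 * (n + 1) * inner (a (Suc k)) (n *\<^sub>R d) - 2 * n * inner (a k) ((n + 1) *\<^sub>R d)"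
      by (simp add: inner_simps algebra_simps)
    also have "\<dots> = 2 * (n + 1) * inner (a (Suc k)) (x0 - x (Suc k)) - 2 * n * inner (a k) (x0 - x k)
        - 2 * n * (n + 1) * inner (a (Suc k)) (a k) + 2 * n * n * (norm (a k))\<^sup>2"
      unfolding d1 d2 power2_norm_eq_inner by (simp add: inner_diff_right algebra_simps)
    finally have "(n + 1) * (n * (norm (a (Suc k)))\<^sup>2 - 2 * inner (a (Suc k)) (x0 - x (Suc k)))
        \<le> n * ((n - 1) * (norm (a k))\<^sup>2 - 2 * inner (a k) (x0 - x k))"
      by (simp add: power2_norm_eq_inner inner_diff_left inner_diff_right inner_commute algebra_simps)
    also have "\<dots> \<le> 0" using Suc.IH by (simp add: n_def)
    finally show ?case by (simp add: n_def add.commute)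
  qed
  then show ?thesis by (simp add: mult_le_0_iff x_def)
qed

text \<open>The potential bound gives weight \<open>k\<close> to the squared residual; cocoercivity
  against the fixed point \<open>xs\<close> supplies one more and replaces the iterate by
  \<open>xs\<close>. Cauchy-Schwarz and cancelling one factor \<open>norm a\<close> finish.\<close>

lemma halpern_rate:
  fixes P :: "'a::real_inner \<Rightarrow> 'a"
  assumes nonexp: "\<And>x y. norm (P x - P y) \<le> norm (x - y)" and fixed: "P xs = xs"
  shows "(real k + 1) * norm (halpern P x0 k - P (halpern P x0 k)) \<le> 2 * norm (x0 - xs)"
proof -
  define x where "x = halpern P x0 k"
  define a where "a = x - P x"
  have "real k * (norm a)\<^sup>2 \<le> 2 * inner a (x0 - x)"
    using halpern_potential[OF nonexp, of k x0] by (simp add: a_def x_def)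
  moreover have "(norm a)\<^sup>2 \<le> 2 * inner a (x - xs)"
    using nonexpansive_residual_cocoercive[of P x xs, OF nonexp] by (simp add: a_def fixed)
  moreover have "inner a (x0 - xs) = inner a (x0 - x) + inner a (x - xs)"
    by (simp add: inner_simps)
  ultimately have "(real k + 1) * (norm a)\<^sup>2 \<le> 2 * inner a (x0 - xs)" by (simp add: algebra_simps)
  also have "\<dots> \<le> 2 * (norm a * norm (x0 - xs))" using norm_cauchy_schwarz by simp
  finally have "norm a * ((real k + 1) * norm a) \<le> norm a * (2 * norm (x0 - xs))"
    by (simp add: power2_eq_square algebra_simps)
  then have "(real k + 1) * norm a \<le> 2 * norm (x0 - xs)"
    by (cases "a = 0") (simp, simp only: mult_le_cancel_left_pos zero_less_norm_iff simp_thms)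
  then show ?thesis by (simp add: a_def x_def)
qed

section \<open>Propagation of the errors\<close>

text \<open>Both sequences share the anchor \<open>z 0\<close>, so it cancels in their difference.
  The remaining factor \<open>(k + 1) / (k + 2)\<close> is absorbed by the weight, and step
  \<open>k\<close> adds at most \<open>(k + 1) * \<epsilon> k\<close>.\<close>

lemma inexact_halpern_deviation:
  fixes P :: "'a::real_normed_vector \<Rightarrow> 'a"
  assumes nonexp: "\<And>x y. norm (P x - P y) \<le> norm (x - y)"
    and err: "\<And>k. norm (zbar k - P (z k)) \<le> \<epsilon> k"
    and step: "\<And>k. z (Suc k) = (1 / (real k + 2)) *\<^sub>R z 0 + ((real k + 1) / (real k + 2)) *\<^sub>R zbar k"
  shows "(real k + 1) * norm (z k - halpern P (z 0) k) \<le> (\<Sum>j<k. (real j + 1) * \<epsilon> j)"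
proof (induction k)
  case 0
  then show ?case by simp
next
  case (Suc k)
  have "z (Suc k) - halpern P (z 0) (Suc k) = ((real k + 1) / (real k + 2)) *\<^sub>R (zbar k - P (halpern P (z 0) k))"
    by (simp add: step scaleR_diff_right)
  then have "(real (Suc k) + 1) * norm (z (Suc k) - halpern P (z 0) (Suc k))
      = (real k + 1) * norm (zbar k - P (halpern P (z 0) k))"
    by (simp add: add.commute)
  also have "\<dots> \<le> (real k + 1) * (\<epsilon> k + norm (z k - halpern P (z 0) k))"
  proof (rule mult_left_mono)
    show "norm (zbar k - P (halpern P (z 0) k)) \<le> \<epsilon> k + norm (z k - halpern P (z 0) k)"
      using norm_triangle_le[of "zbar k - P (z k)" "P (z k) - P (halpern P (z 0) k)"]
        err[of k] nonexp[of "z k" "halpern P (z 0) k"] by simp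
  qed simp
  also have "\<dots> \<le> (\<Sum>j<Suc k. (real j + 1) * \<epsilon> j)" using Suc.IH by (simp add: algebra_simps)
  finally show ?case .
qed

text \<open>The residual \<open>I - P\<close> is 2-Lipschitz, which turns the deviation from the
  exact iterates into the second term.\<close>

lemma inexact_halpern_rate:
  fixes P :: "'a::real_inner \<Rightarrow> 'a"
  assumes nonexp: "\<And>x y. norm (P x - P y) \<le> norm (x - y)" and fixed: "P xs = xs"
    and err: "\<And>k. norm (zbar k - P (z k)) \<le> \<epsilon> k"
    and step: "\<And>k. z (Suc k) = (1 / (real k + 2)) *\<^sub>R z 0 + ((real k + 1) / (real k + 2)) *\<^sub>R zbar k"
  shows "(real k + 1) * norm (z k - P (z k)) \<le> 2 * norm (z 0 - xs) + 2 * (\<Sum>j<k. (real j + 1) * \<epsilon> j)"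
proof -
  define w where "w = halpern P (z 0) k"
  have "norm (z k - P (z k)) \<le> norm (w - P w) + 2 * norm (z k - w)"
    using norm_triangle_ineq[of "z k - w" "w - P w"] norm_triangle_ineq[of "z k - P w" "P w - P (z k)"]
      nonexp[of w "z k"] by (simp add: norm_minus_commute)
  then have "(real k + 1) * norm (z k - P (z k)) \<le> (real k + 1) * (norm (w - P w) + 2 * norm (z k - w))"
    by (intro mult_left_mono) auto
  then show ?thesis
    using halpern_rate[OF nonexp fixed, of k "z 0"] inexact_halpern_deviation[OF nonexp err step, of k]
    by (simp add: w_def algebra_simps)
qed

section \<open>Weighted sums of the tolerances\<close>

text \<open>Comparison with the integral of \<open>t powr - s\<close>, one summand at a time, by the
  mean value theorem for the function \<open>t powr (1 - s)\<close>.\<close>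

lemma sum_powr_neg_le:
  fixes s :: real
  assumes "0 < s" "s < 1"
  shows "(\<Sum>j<k. (real j + 2) powr - s) \<le> (real k + 1) powr (1 - s) / (1 - s)"
proof (induction k)
  case 0
  then show ?case using assms by simp
next
  case (Suc k)
  have "\<exists>y>real k + 1. y < real k + 2 \<and> (real k + 2) powr (1 - s) - (real k + 1) powr (1 - s)
      = (real k + 2 - (real k + 1)) * ((1 - s) * y powr (1 - s - 1))"
    by (rule MVT2) (auto intro!: derivative_eq_intros)
  then obtain y where y: "real k + 1 < y" "y < real k + 2"
    and eq: "(real k + 2) powr (1 - s) - (real k + 1) powr (1 - s) = (1 - s) * y powr - s"
    by auto
  have "(real k + 2) powr - s \<le> y powr - s" using y assms by (intro powr_mono2') auto
  then have "(1 - s) * (real k + 2) powr - s \<le> (real k + 2) powr (1 - s) - (real k + 1) powr (1 - s)"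
    unfolding eq using assms by (intro mult_left_mono) auto
  then have "(real k + 2) powr - s \<le> ((real k + 2) powr (1 - s) - (real k + 1) powr (1 - s)) / (1 - s)"
    using assms by (simp add: field_simps)
  then show ?case using Suc.IH by (simp add: diff_divide_distrib add.commute)
qed

lemma sum_inverse_square_le: "(\<Sum>j<k. 1 / (real j + 2)\<^sup>2) \<le> 1 - 1 / (real k + 1)"
proof (induction k)
  case 0
  then show ?case by simp
next
  case (Suc k)
  have "1 / (real k + 2)\<^sup>2 \<le> 1 / (real k + 1) - 1 / (real k + 2)"
    by (simp add: divide_simps power2_eq_square)
  then show ?case using Suc.IH by (simp add: add.commute)
qed

lemma weighted_tolerance_sum_le:
  fixes \<delta> :: real
  assumes "0 < \<delta>" "\<delta> < 2"
  shows "(\<Sum>j<k. (real j + 1) * (1 / (real j + 2) powr (1 + \<delta>))) \<le> (real k + 1) powr (1 - \<delta> / 2) / (1 - \<delta> / 2)"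
proof -
  have "(real j + 1) * (1 / (real j + 2) powr (1 + \<delta>)) \<le> (real j + 2) powr - (\<delta> / 2)" for j
  proof -
    have "(real j + 1) * (1 / (real j + 2) powr (1 + \<delta>)) \<le> (real j + 2) * (1 / (real j + 2) powr (1 + \<delta>))"
      by (intro mult_right_mono) auto
    also have "\<dots> = (real j + 2) powr - \<delta>"
      by (simp add: powr_add powr_minus_divide add_eq_0_iff_both_eq_0)
    \<comment> \<open>Halving the exponent puts it in (0, 1) for every \<open>\<delta>\<close> below
      2, avoiding a case split at \<open>\<delta> = 1\<close>; division by \<open>k + 1\<close>
      still yields the target rate \<open>\<delta> / 2\<close>.\<close>
    also have "\<dots> \<le> (real j + 2) powr - (\<delta> / 2)" using assms by (intro powr_mono) auto
    finally show ?thesis .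
  qed
  then have "(\<Sum>j<k. (real j + 1) * (1 / (real j + 2) powr (1 + \<delta>))) \<le> (\<Sum>j<k. (real j + 2) powr - (\<delta> / 2))"
    by (intro sum_mono)
  then show ?thesis using sum_powr_neg_le[of "\<delta> / 2" k] assms by simp
qed

lemma weighted_tolerance_sum_le_1:
  fixes \<delta> :: real
  assumes "\<delta> \<ge> 2"
  shows "(\<Sum>j<k. (real j + 1) * (1 / (real j + 2) powr (1 + \<delta>))) \<le> 1"
proof -
  have "(real j + 1) * (1 / (real j + 2) powr (1 + \<delta>)) \<le> 1 / (real j + 2)\<^sup>2" for j
  proof -
    have "(real j + 2) powr 3 \<le> (real j + 2) powr (1 + \<delta>)" using assms by (intro powr_mono) auto
    moreover have "(real j + 2) powr 3 = (real j + 2) ^ 3" using powr_realpow[of "real j + 2" 3] by simp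
    ultimately have "(real j + 1) * (1 / (real j + 2) powr (1 + \<delta>)) \<le> (real j + 2) * (1 / (real j + 2) ^ 3)"
      by (intro mult_mono divide_left_mono) auto
    also have "\<dots> = 1 / (real j + 2)\<^sup>2" by (simp add: power2_eq_square power3_eq_cube)
    finally show ?thesis .
  qed
  then have "(\<Sum>j<k. (real j + 1) * (1 / (real j + 2) powr (1 + \<delta>))) \<le> (\<Sum>j<k. 1 / (real j + 2)\<^sup>2)"
    by (intro sum_mono)
  also have "\<dots> \<le> 1 - 1 / (real k + 1)" by (rule sum_inverse_square_le)
  also have "\<dots> \<le> 1" by simp
  finally show ?thesis .
qed

section \<open>The three ranges of \<delta>\<close>

text \<open>The prefactors in the claimed bounds are independent of \<open>k\<close>; a positive one
  is absorbed into the implicit constant as \<open>D / s\<close>.\<close>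

lemma le_bigO_scaleI:
  assumes "\<And>k. k \<ge> 1 \<Longrightarrow> a k \<le> D * b k" and "D > 0" and "s > 0"
  shows "le_bigO a (\<lambda>k. s * b k)"
  unfolding le_bigO_def using assms by (intro exI[of _ "D / s"]) auto

theorem corollary3p1:
  fixes T :: "'a::{real_inner, complete_space} \<Rightarrow> 'a set"
    and z :: "nat \<Rightarrow> 'a" and zs :: 'a
    and c \<delta> \<beta>\<^sub>0 \<kappa>\<^sub>0 :: real and \<epsilon> :: "nat \<Rightarrow> real"
  assumes "maximal_monotone T"
    and "zs \<in> inv_operator T 0"
    and "\<delta> > 0" and "c > 0"
    and "\<epsilon> = (\<lambda>k. 1 / (real k + 2) powr (1 + \<delta>))"
    and "halpern_inexact_ppa T (\<lambda>k. c) \<epsilon> z"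
    and "\<beta>\<^sub>0 = (\<Sum>k. 1 / (real k + 2) powr (1 + \<delta>))"
    and "\<kappa>\<^sub>0 = 2 * (\<beta>\<^sub>0 + norm (z 0 - zs))"
  shows "(\<delta> < 2 \<longrightarrow>
            le_bigO (\<lambda>k. norm (z k - prox T c (z k)))
              (\<lambda>k. sqrt (8 * \<kappa>\<^sub>0 / (2 - \<delta>)) * (1 / (real k + 1) powr (\<delta> / 2)))) \<and>
         (\<delta> = 2 \<longrightarrow>
            le_bigO (\<lambda>k. norm (z k - prox T c (z k)))
              (\<lambda>k. sqrt (8 * \<kappa>\<^sub>0 * (ln (real k + 1) / (real k + 1) ^ 2)))) \<and>
         (\<delta> > 2 \<longrightarrow>
            le_bigO (\<lambda>k. norm (z k - prox T c (z k)))
              (\<lambda>k. sqrt (8 * \<kappa>\<^sub>0 * (1 / (\<delta> - 1) + 1 / (\<delta> - 2) + \<beta>\<^sub>0) + 4 * norm (z 0 - zs) ^ 2)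
                    * (1 / (real k + 1))))"

proof (intro conjI impI)
  define P where "P = prox T c"
  define d where "d = norm (z 0 - zs)"
  define r where "r = (\<lambda>k. norm (z k - P (z k)))"
  have [simp]: "(\<lambda>k. norm (z k - prox T c (z k))) = r" by (simp add: r_def P_def)
  have nonexp: "norm (P x - P y) \<le> norm (x - y)" for x y
    unfolding P_def using assms by (intro prox_nonexpansive)
  have "P zs = zs"
    unfolding P_def using assms
    by (intro prox_eqI[of _ _ 0]) (auto simp: maximal_monotone_def inv_operator_def)
  obtain zbar where A: "criterion_A T (\<lambda>k. c) \<epsilon> z zbar"
    and step: "\<And>k. z (Suc k) = (1 / (real k + 2)) *\<^sub>R z 0 + ((real k + 1) / (real k + 2)) *\<^sub>R zbar k"
    using assms(6) unfolding halpern_inexact_ppa_def by blast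
  have err: "norm (zbar k - P (z k)) \<le> \<epsilon> k" for k
    using A by (simp add: criterion_A_def P_def)
  have rate: "(real k + 1) * r k \<le> 2 * d + 2 * (\<Sum>j<k. (real j + 1) * (1 / (real j + 2) powr (1 + \<delta>)))" for k
    using inexact_halpern_rate[OF nonexp \<open>P zs = zs\<close> err step, of k] unfolding r_def d_def assms(5) .
  have "summable \<epsilon>" using A by (simp add: criterion_A_def)
  then have "\<beta>\<^sub>0 > 0" unfolding assms(7) assms(5) by (intro suminf_pos) auto
  have "d \<ge> 0" by (simp add: d_def)
  \<comment> \<open>Positivity comes from \<open>\<beta>\<^sub>0\<close>, so it also covers
    \<open>z 0 = zs\<close>; it keeps the prefactors of all three bounds positive.\<close>
  have "\<kappa>\<^sub>0 > 0" using \<open>\<beta>\<^sub>0 > 0\<close> by (simp add: assms(8) add_pos_nonneg)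
  have rate1: "r k \<le> (2 * d + 2) * (1 / (real k + 1))" if "\<delta> \<ge> 2" for k
    using rate[of k] weighted_tolerance_sum_le_1[OF that, of k] by (simp add: field_simps)
  {
    assume "\<delta> < 2"
    \<comment> \<open>The term \<open>2 * d\<close> comes from the exact iteration, the other is
      twice the constant of the tolerance sum.\<close>
    define D where "D = 2 * d + 2 / (1 - \<delta> / 2)"
    have "D > 0" using \<open>\<delta> < 2\<close> \<open>d \<ge> 0\<close> by (simp add: D_def add_nonneg_pos)
    have "r k \<le> D * (1 / (real k + 1) powr (\<delta> / 2))" for k
    proof -
      have "1 \<le> (real k + 1) powr (1 - \<delta> / 2)" using \<open>\<delta> < 2\<close> by (intro ge_one_powr_ge_zero) auto
      then have "2 * d \<le> 2 * d * (real k + 1) powr (1 - \<delta> / 2)"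
        using mult_left_mono[of 1 "(real k + 1) powr (1 - \<delta> / 2)" "2 * d"] \<open>d \<ge> 0\<close> by simp
      then have "(real k + 1) * r k \<le> D * (real k + 1) powr (1 - \<delta> / 2)"
        using rate[of k] weighted_tolerance_sum_le[OF \<open>\<delta> > 0\<close> \<open>\<delta> < 2\<close>, of k]
        by (simp add: D_def distrib_right)
      also have "\<dots> = (real k + 1) * (D * (1 / (real k + 1) powr (\<delta> / 2)))"
        by (simp add: powr_diff)
      finally show ?thesis by (simp only: mult_le_cancel_left_pos)
    qed
    then show "le_bigO (\<lambda>k. norm (z k - prox T c (z k)))
        (\<lambda>k. sqrt (8 * \<kappa>\<^sub>0 / (2 - \<delta>)) * (1 / (real k + 1) powr (\<delta> / 2)))"
      using \<open>D > 0\<close> \<open>\<kappa>\<^sub>0 > 0\<close> \<open>\<delta> < 2\<close> by (simp only: \<open>_ = r\<close>, intro le_bigO_scaleI) auto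
  next
    assume "\<delta> = 2"
    \<comment> \<open>For \<open>k \<ge> 1\<close> the least value of
      \<open>sqrt (ln (k + 1))\<close> is \<open>sqrt (ln 2)\<close>; dividing by it lets the rate
      \<open>1 / (k + 1)\<close> pass under the logarithmic one. At \<open>k = 0\<close> the
      logarithm vanishes.\<close>
    define D where "D = (2 * d + 2) / sqrt (ln 2)"
    have "D > 0" using \<open>d \<ge> 0\<close> by (simp add: D_def)
    have bound: "r k \<le> D * (sqrt (ln (real k + 1)) / (real k + 1))" if "k \<ge> 1" for k
    proof -
      have "sqrt (ln 2) \<le> sqrt (ln (real k + 1))" using that by simp
      then have "1 \<le> sqrt (ln (real k + 1)) / sqrt (ln 2)" by simp
      have "r k \<le> (2 * d + 2) * (1 / (real k + 1)) * 1" using rate1[of k] \<open>\<delta> = 2\<close> by simp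
      also have "\<dots> \<le> (2 * d + 2) * (1 / (real k + 1)) * (sqrt (ln (real k + 1)) / sqrt (ln 2))"
        using \<open>d \<ge> 0\<close> \<open>1 \<le> sqrt (ln (real k + 1)) / sqrt (ln 2)\<close> by (intro mult_left_mono) auto
      also have "\<dots> = D * (sqrt (ln (real k + 1)) / (real k + 1))" by (simp add: D_def)
      finally show ?thesis .
    qed
    have "sqrt (8 * \<kappa>\<^sub>0 * (ln (real k + 1) / (real k + 1) ^ 2))
        = sqrt (8 * \<kappa>\<^sub>0) * (sqrt (ln (real k + 1)) / (real k + 1))" for k
      by (simp add: real_sqrt_mult real_sqrt_divide)
    then show "le_bigO (\<lambda>k. norm (z k - prox T c (z k)))
        (\<lambda>k. sqrt (8 * \<kappa>\<^sub>0 * (ln (real k + 1) / (real k + 1) ^ 2)))"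
      using le_bigO_scaleI[OF bound \<open>D > 0\<close>, where s = "sqrt (8 * \<kappa>\<^sub>0)"] \<open>\<kappa>\<^sub>0 > 0\<close> by simp
  next
    assume "\<delta> > 2"
    have "8 * \<kappa>\<^sub>0 * (1 / (\<delta> - 1) + 1 / (\<delta> - 2) + \<beta>\<^sub>0) + 4 * norm (z 0 - zs) ^ 2 > 0"
      using \<open>\<delta> > 2\<close> \<open>\<kappa>\<^sub>0 > 0\<close> \<open>\<beta>\<^sub>0 > 0\<close> by (intro add_pos_nonneg mult_pos_pos) auto
    then show "le_bigO (\<lambda>k. norm (z k - prox T c (z k)))
        (\<lambda>k. sqrt (8 * \<kappa>\<^sub>0 * (1 / (\<delta> - 1) + 1 / (\<delta> - 2) + \<beta>\<^sub>0) + 4 * norm (z 0 - zs) ^ 2)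
              * (1 / (real k + 1)))"
      using rate1 \<open>\<delta> > 2\<close> \<open>d \<ge> 0\<close>
      by (simp only: \<open>_ = r\<close>, intro le_bigO_scaleI[where D = "2 * d + 2"]) auto
  }
qed

end
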